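(* Let $\Omega$ be a (closed) convex polygon with vertices $\mathbf{v}_1,\dots,\mathbf{v}_n$, let $\{\lambda_i\}_{i=1}^n$ be barycentric coordinates on $\Omega$, let $\xi_{ij}$ ($ij\in V\cup E$) be the serendipity functions $[\xi_{ij}]=\mathbb{A}[\mu_{ab}]$ with $\mathbb{A}=[\,\mathbb{I}\mid\mathbb{A}'\,]$ as described in the context, and define $$\psi_{ii}:=\xi_{ii}-\xi_{i(i+1)}-\xi_{(i-1)i},\qquad \psi_{i(i+1)}:=4\,\xi_{i(i+1)},\qquad i=1,\dots,n.$$ Then for all $i,j\in\{1,\dots,n\}$, $$\psi_{ii}(\mathbf{v}_j)=\delta_{ij},\qquad \psi_{ii}(\mathbf{v}_{j(j+1)})=0,\qquad \psi_{i(i+1)}(\mathbf{v}_j)=0,\qquad \psi_{i(i+1)}(\mathbf{v}_{j(j+1)})=\delta_{ij}.$$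
   Context: Vertices are ordered counter-clockwise; vertex indices are taken modulo $n$. Barycentric coordinates on $\Omega$ are functions $\lambda_i:\Omega\to\mathbb{R}$, $i=1,\dots,n$, with $\lambda_i\ge 0$ on $\Omega$ and $L=\sum_{i=1}^n L(\mathbf{v}_i)\lambda_i$ on $\Omega$ for every linear (i.e. affine, degree at most one) function $L:\Omega\to\mathbb{R}$. Index sets: $I=\{\{a,b\}: a,b\in\{1,\dots,n\}\}$ is the set of unordered, possibly non-distinct pairs; $V=\{\{a,a\}\}$, $E=\{\{a,a+1\}: a=1,\dots,n\}$, $D=I\setminus(V\cup E)$. One writes $ab$ for $\{a,b\}$, and $\mathbf{v}_{ab}:=(\mathbf{v}_a+\mathbf{v}_b)/2$. $\mu_{ab}:=\lambda_a\lambda_b$ for $ab\in I$. Serendipity functions: $\xi_{ij}=\sum_{ab\in I}c^{ij}_{ab}\mu_{ab}$ for $ij\in V\cup E$, where for $ab\in V\cup E$ one has $c^{ij}_{ab}=1$ if $ij=ab$ and $0$ otherwise (the identity block of $\mathbb{A}$), and the entries $c^{ij}_{ab}$ with $ab\in D$ (the block $\mathbb{A}'$) are real numbers; i.e. $\xi_{ij}$ equals $\mu_{ij}$ plus a linear combination of the functions $\mu_{ab}$ with $ab\in D$. *)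

theory Defs
  imports "HOL-Analysis.Analysis" "HOL-Library.Uprod"
begin

text \<open>Vertex indices range over \<open>{1..n}\<close> and are read cyclically.\<close>

definition nxt :: "nat \<Rightarrow> nat \<Rightarrow> nat" where
  "nxt n i = (if i = n then 1 else i + 1)"

definition prv :: "nat \<Rightarrow> nat \<Rightarrow> nat" where
  "prv n i = (if i = 1 then n else i - 1)"

definition cross2 :: "real^2 \<Rightarrow> real^2 \<Rightarrow> real" where
  "cross2 p q = p $ 1 * q $ 2 - p $ 2 * q $ 1"

text \<open>
  A vertex of the polygon is a genuine corner (an extreme point), so that no three vertices
  are collinear. The last condition is the counter-clockwise ordering: walking from
  \<open>v i\<close> to the next vertex keeps the whole polygon on the left.
\<close>

definition convex_polygon :: "nat \<Rightarrow> (nat \<Rightarrow> real^2) \<Rightarrow> (real^2) set \<Rightarrow> bool" where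
  "convex_polygon n v \<Omega> \<longleftrightarrow>
     3 \<le> n \<and> \<Omega> = convex hull (v ` {1..n}) \<and> inj_on v {1..n} \<and>
     (\<forall>i\<in>{1..n}. v i extreme_point_of \<Omega>) \<and>
     (\<forall>i\<in>{1..n}. \<forall>x\<in>\<Omega>. cross2 (v (nxt n i) - v i) (x - v i) \<ge> 0)"

definition affine_fun :: "(real^2 \<Rightarrow> real) \<Rightarrow> bool" where
  "affine_fun L \<longleftrightarrow> (\<exists>g c. linear g \<and> L = (\<lambda>x. g x + c))"

text \<open>
  The functions are total; only their values on \<open>\<Omega>\<close> matter. Every affine function on \<open>\<Omega>\<close>
  is the restriction of an affine function on the plane.
\<close>

definition barycentric_coords ::
    "nat \<Rightarrow> (nat \<Rightarrow> real^2) \<Rightarrow> (real^2) set \<Rightarrow> (nat \<Rightarrow> real^2 \<Rightarrow> real) \<Rightarrow> bool" where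
  "barycentric_coords n v \<Omega> lam \<longleftrightarrow>
     (\<forall>i\<in>{1..n}. \<forall>x\<in>\<Omega>. lam i x \<ge> 0) \<and>
     (\<forall>L. affine_fun L \<longrightarrow> (\<forall>x\<in>\<Omega>. L x = (\<Sum>i=1..n. L (v i) * lam i x)))"

definition pairs_I :: "nat \<Rightarrow> nat uprod set" where
  "pairs_I n = {Upair a b | a b. a \<in> {1..n} \<and> b \<in> {1..n}}"

definition pairs_V :: "nat \<Rightarrow> nat uprod set" where
  "pairs_V n = {Upair a a | a. a \<in> {1..n}}"

definition pairs_E :: "nat \<Rightarrow> nat uprod set" where
  "pairs_E n = {Upair a (nxt n a) | a. a \<in> {1..n}}"

definition pairs_D :: "nat \<Rightarrow> nat uprod set" where
  "pairs_D n = pairs_I n - (pairs_V n \<union> pairs_E n)"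

lift_definition mu :: "(nat \<Rightarrow> real^2 \<Rightarrow> real) \<Rightarrow> nat uprod \<Rightarrow> real^2 \<Rightarrow> real"
  is "\<lambda>lam (a, b) x. lam a x * lam b x"
  by (auto simp: fun_eq_iff)

lemma mu_Upair: "mu lam (Upair a b) x = lam a x * lam b x"
  by transfer simp

text \<open>
  The matrix \<open>[ Id | A' ]\<close>: rows are indexed by \<open>V \<union> E\<close>, columns by \<open>I\<close>, and the columns in
  \<open>V \<union> E\<close> form the identity block. The block \<open>A'\<close> (columns in \<open>D\<close>) is arbitrary.
\<close>

definition serendipity_matrix ::
    "nat \<Rightarrow> (nat uprod \<Rightarrow> nat uprod \<Rightarrow> real) \<Rightarrow> nat uprod \<Rightarrow> nat uprod \<Rightarrow> real" where
  "serendipity_matrix n A' ij ab =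
     (if ab \<in> pairs_D n then A' ij ab else if ij = ab then 1 else 0)"

definition xi ::
    "nat \<Rightarrow> (nat uprod \<Rightarrow> nat uprod \<Rightarrow> real) \<Rightarrow> (nat \<Rightarrow> real^2 \<Rightarrow> real) \<Rightarrow>
     nat uprod \<Rightarrow> real^2 \<Rightarrow> real" where
  "xi n A' lam ij x = (\<Sum>ab\<in>pairs_I n. serendipity_matrix n A' ij ab * mu lam ab x)"

text \<open>\<open>psi_vertex \<dots> i\<close> is $\psi_{ii}$ and \<open>psi_edge \<dots> i\<close> is $\psi_{i(i+1)}$.\<close>

definition psi_vertex ::
    "nat \<Rightarrow> (nat uprod \<Rightarrow> nat uprod \<Rightarrow> real) \<Rightarrow> (nat \<Rightarrow> real^2 \<Rightarrow> real) \<Rightarrow>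
     nat \<Rightarrow> real^2 \<Rightarrow> real" where
  "psi_vertex n A' lam i x =
     xi n A' lam (Upair i i) x - xi n A' lam (Upair i (nxt n i)) x
       - xi n A' lam (Upair (prv n i) i) x"

definition psi_edge ::
    "nat \<Rightarrow> (nat uprod \<Rightarrow> nat uprod \<Rightarrow> real) \<Rightarrow> (nat \<Rightarrow> real^2 \<Rightarrow> real) \<Rightarrow>
     nat \<Rightarrow> real^2 \<Rightarrow> real" where
  "psi_edge n A' lam i x = 4 * xi n A' lam (Upair i (nxt n i)) x"

end

theory Submission
  imports Defs
begin

text \<open>
  The claim reduces to the values of the coordinates \<open>lam i\<close> at the vertices and at the edge
  midpoints. At an extreme point of \<open>\<Omega>\<close> only the trivial convex combination of the vertices is
  possible, hence \<open>lam i (v j)\<close> is the Kronecker delta (\<open>lam_at_vertex\<close>). On an edge, the affine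
  function that measures the signed distance from the edge line vanishes, yet it is a combination of
  its nonnegative vertex values with nonnegative weights; so only vertices on the edge line carry
  weight. As no three vertices are collinear, these are the two endpoints, and at the midpoint each
  has weight one half (\<open>lam_at_edge_midpoint\<close>).

  At every one of these points the support of the coordinates is contained in a single edge.
  All diagonal products \<open>mu lam ab\<close>, \<open>ab \<in> pairs_D n\<close>, vanish there, so the arbitrary
  block \<open>A'\<close> drops out and \<open>xi\<close> coincides with \<open>mu\<close> (\<open>xi_eq_mu\<close>). What is left are
  products of the numbers 0, 1 and one half: the factor 4 in \<open>psi_edge\<close> normalises
  one quarter, and the two terms subtracted in \<open>psi_vertex\<close> cancel the value one quarter
  which the square of \<open>lam i\<close> takes at the midpoints of the two edges at \<open>v i\<close>.
\<close>

section \<open>Cyclic indices\<close>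

lemma nxt_in: "i \<in> {1..n} \<Longrightarrow> nxt n i \<in> {1..n}"
  by (auto simp: nxt_def)

lemma prv_in: "i \<in> {1..n} \<Longrightarrow> prv n i \<in> {1..n}"
  by (auto simp: prv_def)

lemma nxt_prv: "i \<in> {1..n} \<Longrightarrow> nxt n (prv n i) = i"
  by (auto simp: nxt_def prv_def)

lemma prv_nxt: "i \<in> {1..n} \<Longrightarrow> prv n (nxt n i) = i"
  by (auto simp: nxt_def prv_def)

lemma nxt_neq: "3 \<le> n \<Longrightarrow> nxt n i \<noteq> i"
  by (auto simp: nxt_def)

lemma nxt_nxt_neq: "3 \<le> n \<Longrightarrow> nxt n (nxt n i) \<noteq> i"
  by (auto simp: nxt_def split: if_splits)

section \<open>Barycentric coordinates on the boundary\<close>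

lemma linear_cross2: "linear (cross2 d)"
  by (rule linearI) (auto simp: cross2_def algebra_simps)

lemma barycentric_sum_one:
  assumes "barycentric_coords n v \<Omega> lam" "x \<in> \<Omega>"
  shows "(\<Sum>i=1..n. lam i x) = 1"
proof -
  have "affine_fun (\<lambda>_. 1)"
    unfolding affine_fun_def by (intro exI[of _ "\<lambda>_. 0"] exI[of _ 1]) (simp add: linear_zero)
  then show ?thesis
    using assms unfolding barycentric_coords_def by fastforce
qed

lemma barycentric_reproduces_point:
  assumes "barycentric_coords n v \<Omega> lam" "x \<in> \<Omega>"
  shows "(\<Sum>i=1..n. lam i x *\<^sub>R v i) = x"
proof -
  have "(\<Sum>i=1..n. lam i x *\<^sub>R v i) $ k = x $ k" for k
  proof -
    have "affine_fun (\<lambda>y. y $ k)"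
      unfolding affine_fun_def
      by (intro exI[of _ "\<lambda>y. y $ k"] exI[of _ 0])
         (simp add: bounded_linear.linear bounded_linear_vec_nth)
    then have "x $ k = (\<Sum>i=1..n. v i $ k * lam i x)"
      using assms unfolding barycentric_coords_def by fastforce
    then show ?thesis
      by (simp add: mult.commute)
  qed
  then show ?thesis
    by (simp add: vec_eq_iff)
qed

text \<open>
  If the other points had positive total weight, the normalised combination of them would again
  be the extreme point. But removing an extreme point from a convex set leaves a convex set,
  which must contain that combination.
\<close>

lemma convex_combination_extreme_point:
  fixes p :: "'i \<Rightarrow> 'a::real_normed_vector"
  assumes "convex S" "p j extreme_point_of S" "finite A" "j \<in> A" "inj_on p A" "p ` A \<subseteq> S"
    and nonneg: "\<And>i. i \<in> A \<Longrightarrow> w i \<ge> 0"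
    and one: "sum w A = 1" and comb: "(\<Sum>i\<in>A. w i *\<^sub>R p i) = p j"
    and "i \<in> A"
  shows "w i = (if i = j then 1 else 0)"
proof -
  define r where "r = sum w (A - {j})"
  have r: "w j = 1 - r"
    using one sum.remove[of A j w] assms by (simp add: r_def)
  have "r \<ge> 0"
    unfolding r_def by (rule sum_nonneg) (use nonneg in auto)
  have "r = 0"
  proof (rule ccontr)
    assume "r \<noteq> 0"
    define y where "y = (\<Sum>i\<in>A-{j}. (w i / r) *\<^sub>R p i)"
    have cvx: "convex (S - {p j})"
      using assms(1,2) extreme_point_of_stillconvex by blast
    have "y \<in> S - {p j}"
      unfolding y_def
    proof (rule convex_sum[OF _ cvx])
      show "(\<Sum>i\<in>A-{j}. w i / r) = 1"
        using \<open>r \<noteq> 0\<close> by (simp add: r_def flip: sum_divide_distrib)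
      show "p i \<in> S - {p j}" if "i \<in> A - {j}" for i
        using that assms(4-6) by (auto dest: inj_onD)
    qed (use assms \<open>r \<ge> 0\<close> in auto)
    moreover have "r *\<^sub>R y = (\<Sum>i\<in>A-{j}. w i *\<^sub>R p i)"
      using \<open>r \<noteq> 0\<close> by (simp add: y_def scaleR_sum_right)
    then have "r *\<^sub>R y = r *\<^sub>R p j"
      using comb sum.remove[of A j "\<lambda>i. w i *\<^sub>R p i"] assms(3,4) r
      by (simp add: algebra_simps)
    then have "y = p j"
      using \<open>r \<noteq> 0\<close> by simp
    ultimately show False by simp
  qed
  then have "\<forall>i\<in>A-{j}. w i = 0"
    unfolding r_def using assms(3) nonneg by (subst (asm) sum_nonneg_eq_0_iff) auto
  then show ?thesis
    using \<open>i \<in> A\<close> r \<open>r = 0\<close> by auto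
qed

lemma vertex_in_polygon:
  assumes "convex_polygon n v \<Omega>" "i \<in> {1..n}"
  shows "v i \<in> \<Omega>"
  using assms unfolding convex_polygon_def by (auto intro: hull_inc)

lemma lam_at_vertex:
  assumes poly: "convex_polygon n v \<Omega>" and bary: "barycentric_coords n v \<Omega> lam"
    and "i \<in> {1..n}" "j \<in> {1..n}"
  shows "lam i (v j) = (if i = j then 1 else 0)"
proof (rule convex_combination_extreme_point[where S = \<Omega> and p = v and A = "{1..n}"])
  have vj: "v j \<in> \<Omega>"
    using vertex_in_polygon assms by blast
  show "sum (\<lambda>i. lam i (v j)) {1..n} = 1" "(\<Sum>i\<in>{1..n}. lam i (v j) *\<^sub>R v i) = v j"
    using barycentric_sum_one[OF bary vj] barycentric_reproduces_point[OF bary vj] by auto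
  show "lam i (v j) \<ge> 0" if "i \<in> {1..n}" for i
    using bary vj that unfolding barycentric_coords_def by blast
  show "v ` {1..n} \<subseteq> \<Omega>"
    using vertex_in_polygon[OF poly] by blast
  show "convex \<Omega>" "v j extreme_point_of \<Omega>" "inj_on v {1..n}"
    using poly \<open>j \<in> {1..n}\<close> unfolding convex_polygon_def by auto
qed (use assms in auto)

text \<open>
  By Lagrange's identity the vanishing of \<open>cross2\<close> is the equality case of the Cauchy-Schwarz
  inequality, which characterises collinearity.
\<close>

lemma cross2_zero_imp_collinear:
  assumes "cross2 (b - a) (c - a) = 0"
  shows "collinear {a, b, c}"
proof -
  define p q where "p = b - a" and "q = c - a"
  have "(p \<bullet> q)\<^sup>2 + (cross2 p q)\<^sup>2 = (p \<bullet> p) * (q \<bullet> q)"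
    by (simp add: cross2_def inner_vec_def sum_2 power2_eq_square algebra_simps)
  then have "(p \<bullet> q)\<^sup>2 = (norm p * norm q)\<^sup>2"
    using assms by (simp add: p_def q_def power_mult_distrib flip: power2_norm_eq_inner)
  then have "\<bar>p \<bullet> q\<bar> = norm p * norm q"
    by (auto simp only: power2_eq_iff abs_minus_cancel abs_mult abs_norm_cancel)
  then have "collinear {0, p, q}"
    by (simp only: norm_cauchy_schwarz_equal)
  then have "collinear {b, a, c}"
    by (subst collinear_3) (simp_all add: p_def q_def)
  then show ?thesis
    by (simp add: insert_commute)
qed

lemma extreme_points_not_collinear:
  fixes a b c :: "'a::euclidean_space"
  assumes "a extreme_point_of S" "b extreme_point_of S" "c extreme_point_of S"
    and "a \<noteq> b" "a \<noteq> c" "b \<noteq> c"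
  shows "\<not> collinear {a, b, c}"
proof
  assume "collinear {a, b, c}"
  then have "a \<in> open_segment b c \<or> b \<in> open_segment c a \<or> c \<in> open_segment a b"
    unfolding collinear_between_cases between_mem_segment open_segment_def
    using assms(4-6) by blast
  then show False
    using assms(1-3) unfolding extreme_point_of_def by blast
qed

text \<open>
  The edge function \<open>L\<close> below is nonnegative at all vertices and vanishes at \<open>x\<close>, so every
  summand of \<open>L x = (\<Sum>i=1..n. L (v i) * lam i x)\<close> is zero; and \<open>L (v i) = 0\<close> is
  possible only at the two endpoints.
\<close>

lemma lam_off_edge:
  assumes poly: "convex_polygon n v \<Omega>" and bary: "barycentric_coords n v \<Omega> lam"
    and i: "i \<in> {1..n}" and j: "j \<in> {1..n}" and "i \<noteq> j" "i \<noteq> nxt n j"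
    and x: "x \<in> closed_segment (v j) (v (nxt n j))"
  shows "lam i x = 0"
proof -
  define d where "d = v (nxt n j) - v j"
  define L where "L = (\<lambda>y. cross2 d (y - v j))"
  have n: "3 \<le> n" and inj: "inj_on v {1..n}"
    and ext: "\<And>k. k \<in> {1..n} \<Longrightarrow> v k extreme_point_of \<Omega>"
    and \<Omega>: "convex \<Omega>"
    using poly unfolding convex_polygon_def by auto
  have j': "nxt n j \<in> {1..n}"
    using j by (rule nxt_in)
  have "x \<in> \<Omega>"
    using x \<Omega> vertex_in_polygon[OF poly] j j' closed_segment_subset by blast
  have Lpos: "L (v k) \<ge> 0" if "k \<in> {1..n}" for k
    using poly j vertex_in_polygon[OF poly that]
    unfolding convex_polygon_def L_def d_def by blast
  obtain t where "x = (1 - t) *\<^sub>R v j + t *\<^sub>R v (nxt n j)"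
    using x by (auto simp: in_segment)
  then have "x - v j = t *\<^sub>R d"
    by (simp add: d_def algebra_simps)
  then have "L x = t * cross2 d d"
    unfolding L_def by (simp only: linear_scale[OF linear_cross2] real_scaleR_def)
  then have "L x = 0"
    by (simp add: cross2_def)
  moreover have "affine_fun L"
    unfolding affine_fun_def
    by (intro exI[of _ "cross2 d"] exI[of _ "- cross2 d (v j)"])
       (auto simp: L_def linear_cross2 linear_diff)
  then have "L x = (\<Sum>k=1..n. L (v k) * lam k x)"
    using bary \<open>x \<in> \<Omega>\<close> unfolding barycentric_coords_def by blast
  ultimately have "(\<Sum>k=1..n. L (v k) * lam k x) = 0"
    by simp
  moreover have "L (v k) * lam k x \<ge> 0" if "k \<in> {1..n}" for k
    using Lpos[OF that] bary \<open>x \<in> \<Omega>\<close> that unfolding barycentric_coords_def by simp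
  ultimately have "L (v i) * lam i x = 0"
    using i by (subst (asm) sum_nonneg_eq_0_iff) auto
  moreover have "L (v i) \<noteq> 0"
  proof -
    have "v j \<noteq> v (nxt n j)" "v j \<noteq> v i" "v (nxt n j) \<noteq> v i"
      using inj_onD[OF inj _ j j'] inj_onD[OF inj _ j i] inj_onD[OF inj _ j' i]
        \<open>i \<noteq> j\<close> \<open>i \<noteq> nxt n j\<close> nxt_neq[OF n, of j] by auto
    then have "\<not> collinear {v j, v (nxt n j), v i}"
      using extreme_points_not_collinear ext i j j' by blast
    then show ?thesis
      unfolding L_def d_def using cross2_zero_imp_collinear by blast
  qed
  ultimately show ?thesis by simp
qed

lemma lam_at_edge_midpoint:
  assumes poly: "convex_polygon n v \<Omega>" and bary: "barycentric_coords n v \<Omega> lam"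
    and i: "i \<in> {1..n}" and j: "j \<in> {1..n}"
  shows "lam i (midpoint (v j) (v (nxt n j))) = (if i = j \<or> i = nxt n j then 1 / 2 else 0)"
proof -
  define m where "m = midpoint (v j) (v (nxt n j))"
  have n: "3 \<le> n" and inj: "inj_on v {1..n}" and \<Omega>: "convex \<Omega>"
    using poly unfolding convex_polygon_def by auto
  have j': "nxt n j \<in> {1..n}" "nxt n j \<noteq> j"
    using j n nxt_in nxt_neq by blast+
  have m: "m \<in> closed_segment (v j) (v (nxt n j))"
    by (simp add: m_def)
  then have "m \<in> \<Omega>"
    using \<Omega> vertex_in_polygon[OF poly] j j' closed_segment_subset by blast
  have off: "lam k m = 0" if "k \<in> {1..n} - {j, nxt n j}" for k
    by (rule lam_off_edge[OF poly bary _ j _ _ m]) (use that in auto)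
  have "(\<Sum>k\<in>{j, nxt n j}. lam k m) = (\<Sum>k=1..n. lam k m)"
    by (rule sum.mono_neutral_left) (use j j' off in auto)
  then have one: "lam (nxt n j) m = 1 - lam j m"
    using barycentric_sum_one[OF bary \<open>m \<in> \<Omega>\<close>] j' by simp
  have "(\<Sum>k\<in>{j, nxt n j}. lam k m *\<^sub>R v k) = (\<Sum>k=1..n. lam k m *\<^sub>R v k)"
    by (rule sum.mono_neutral_left) (use j j' off in auto)
  then have "lam j m *\<^sub>R v j + (1 - lam j m) *\<^sub>R v (nxt n j) = m"
    using barycentric_reproduces_point[OF bary \<open>m \<in> \<Omega>\<close>] j' one by simp
  then have "2 *\<^sub>R (lam j m *\<^sub>R v j + (1 - lam j m) *\<^sub>R v (nxt n j)) = v j + v (nxt n j)"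
    by (simp add: m_def midpoint_def)
  then have "(2 * lam j m - 1) *\<^sub>R (v j - v (nxt n j)) = 0"
    by (simp add: algebra_simps scaleR_2)
  moreover have "v j \<noteq> v (nxt n j)"
    using inj_onD[OF inj _ j j'(1)] j'(2) by auto
  ultimately have "lam j m = 1 / 2"
    by simp
  then show ?thesis
    using one off[of i] i unfolding m_def[symmetric] by auto
qed

section \<open>Serendipity functions where the diagonal products vanish\<close>

lemma finite_pairs_I: "finite (pairs_I n)"
  unfolding pairs_I_def by (rule finite_image_set2) simp_all

lemma pairs_VE_subset_I: "pairs_V n \<union> pairs_E n \<subseteq> pairs_I n"
  unfolding pairs_V_def pairs_E_def pairs_I_def using nxt_in by blast

text \<open>
  At \<open>x\<close> only the two ends of a single edge carry weight. Hence every \<open>mu\<close> with index in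
  \<open>pairs_D n\<close> vanishes at \<open>x\<close>, and the rest of the matrix is the identity.
\<close>

lemma xi_eq_mu:
  assumes supp: "\<And>k. k \<in> {1..n} \<Longrightarrow> k \<noteq> j \<Longrightarrow> k \<noteq> nxt n j \<Longrightarrow> lam k x = 0"
    and ij: "ij \<in> pairs_V n \<union> pairs_E n"
  shows "xi n A' lam ij x = mu lam ij x"
proof -
  have D: "mu lam ab x = 0" if "ab \<in> pairs_D n" for ab
  proof -
    obtain a b where ab: "ab = Upair a b" "a \<in> {1..n}" "b \<in> {1..n}"
      using \<open>ab \<in> pairs_D n\<close> by (auto simp: pairs_D_def pairs_I_def)
    have "ab \<notin> pairs_V n" "ab \<notin> pairs_E n"
      using \<open>ab \<in> pairs_D n\<close> by (auto simp: pairs_D_def)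
    then have "a \<noteq> b" "\<not> (a = j \<and> b = nxt n j)" "\<not> (b = j \<and> a = nxt n j)"
      using ab unfolding pairs_V_def pairs_E_def by auto
    then have "(a \<noteq> j \<and> a \<noteq> nxt n j) \<or> (b \<noteq> j \<and> b \<noteq> nxt n j)"
      by auto
    then show ?thesis
      using supp ab by (auto simp: mu_Upair)
  qed
  have "xi n A' lam ij x = (\<Sum>ab\<in>pairs_I n. if ij = ab then mu lam ab x else 0)"
    unfolding xi_def
    by (rule sum.cong) (use D in \<open>auto simp: serendipity_matrix_def\<close>)
  also have "\<dots> = mu lam ij x"
    using ij pairs_VE_subset_I finite_pairs_I by auto
  finally show ?thesis .
qed

lemma psi_eq_products:
  assumes "i \<in> {1..n}"
    and "\<And>k. k \<in> {1..n} \<Longrightarrow> k \<noteq> j \<Longrightarrow> k \<noteq> nxt n j \<Longrightarrow> lam k x = 0"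
  shows "psi_vertex n A' lam i x = lam i x * (lam i x - lam (nxt n i) x - lam (prv n i) x)"
    and "psi_edge n A' lam i x = 4 * lam i x * lam (nxt n i) x"
proof -
  have "Upair i i \<in> pairs_V n" "Upair i (nxt n i) \<in> pairs_E n"
    using assms(1) by (auto simp: pairs_V_def pairs_E_def)
  moreover have "Upair (prv n i) i \<in> pairs_E n"
    using prv_in[OF assms(1)] nxt_prv[OF assms(1)] unfolding pairs_E_def by force
  ultimately show "psi_vertex n A' lam i x
      = lam i x * (lam i x - lam (nxt n i) x - lam (prv n i) x)"
    and "psi_edge n A' lam i x = 4 * lam i x * lam (nxt n i) x"
    using xi_eq_mu[of n j lam x] assms(2)
    by (simp_all add: psi_vertex_def psi_edge_def mu_Upair algebra_simps)
qed

section \<open>The Lagrange property\<close>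

theorem proposition6p1:
  fixes n :: nat
    and v :: "nat \<Rightarrow> real^2"
    and \<Omega> :: "(real^2) set"
    and lam :: "nat \<Rightarrow> real^2 \<Rightarrow> real"
    and A' :: "nat uprod \<Rightarrow> nat uprod \<Rightarrow> real"
  assumes "convex_polygon n v \<Omega>"
    and "barycentric_coords n v \<Omega> lam"
  shows "\<forall>i\<in>{1..n}. \<forall>j\<in>{1..n}.
           psi_vertex n A' lam i (v j) = (if i = j then 1 else 0) \<and>
           psi_vertex n A' lam i (midpoint (v j) (v (nxt n j))) = 0 \<and>
           psi_edge n A' lam i (v j) = 0 \<and>
           psi_edge n A' lam i (midpoint (v j) (v (nxt n j))) = (if i = j then 1 else 0)"
proof (intro ballI)
  fix i j
  assume i: "i \<in> {1..n}" and j: "j \<in> {1..n}"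
  let ?m = "midpoint (v j) (v (nxt n j))"
  have n: "3 \<le> n"
    using assms(1) unfolding convex_polygon_def by blast
  note idx = i nxt_in[OF i] prv_in[OF i]
  note V = lam_at_vertex[OF assms _ j] and M = lam_at_edge_midpoint[OF assms _ j]
  have at_v: "psi_vertex n A' lam i (v j)
        = lam i (v j) * (lam i (v j) - lam (nxt n i) (v j) - lam (prv n i) (v j))"
      "psi_edge n A' lam i (v j) = 4 * lam i (v j) * lam (nxt n i) (v j)"
    by (rule psi_eq_products[OF i, of j]; simp add: V)+
  have at_m: "psi_vertex n A' lam i ?m
        = lam i ?m * (lam i ?m - lam (nxt n i) ?m - lam (prv n i) ?m)"
      "psi_edge n A' lam i ?m = 4 * lam i ?m * lam (nxt n i) ?m"
    by (rule psi_eq_products[OF i, of j]; simp add: M)+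
  \<comment> \<open>Since \<open>n \<ge> 3\<close>, the indices \<open>prv n i\<close>, \<open>i\<close> and \<open>nxt n i\<close> are
      pairwise distinct, so the edge at \<open>j\<close> contains exactly one neighbour of \<open>i\<close> whenever it
      contains \<open>i\<close>.\<close>
  have distinct: "nxt n i \<noteq> i" "prv n i \<noteq> i" "nxt n i \<noteq> prv n i"
    using nxt_neq[OF n] nxt_nxt_neq[OF n] nxt_prv[OF i] by metis+
  have edge: "nxt n i = nxt n j \<longleftrightarrow> i = j" "i = nxt n j \<longleftrightarrow> prv n i = j"
      "nxt n i = j \<and> i = nxt n j \<longleftrightarrow> False"
    using nxt_prv prv_nxt i j nxt_nxt_neq[OF n] by metis+
  show "psi_vertex n A' lam i (v j) = (if i = j then 1 else 0) \<and>
        psi_vertex n A' lam i ?m = 0 \<and>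
        psi_edge n A' lam i (v j) = 0 \<and>
        psi_edge n A' lam i ?m = (if i = j then 1 else 0)"
    unfolding at_v at_m V[OF idx(1)] V[OF idx(2)] V[OF idx(3)]
      M[OF idx(1)] M[OF idx(2)] M[OF idx(3)]
    using distinct edge by auto
qed

end
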